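(* Let $\mathcal{G}$ be a minor-closed class of graphs with bounded pathwidth. Then $$\chi_{\Delta}(\mathcal{G}) \le \chi_{\star}(\mathcal{G}) \le 2\operatorname{tcn}(\mathcal{G}) - 2.$$
   Context: All graphs are finite and simple. A $k$-colouring of a graph is any function assigning one of $k$ colours to each vertex; it need not be proper. A monochromatic component is a connected component of the subgraph induced by all vertices of one colour. A colouring has defect $d$ if every monochromatic component has maximum degree at most $d$. A colouring has clustering $c$ if every monochromatic component has at most $c$ vertices. For a graph class $\mathcal{G}$: - $\chi_{\Delta}(\mathcal{G})$ is the minimum integer $k$ such that, for some integer $d$, every graph in $\mathcal{G}$ is $k$-colourable with defect $d$. - $\chi_{\star}(\mathcal{G})$ is the minimum integer $k$ such that, for some integer $c$, every graph in $\mathcal{G}$ is $k$-colourable with clustering $c$. The depth of a rooted tree is the maximum number of vertices on a root-to-leaf path. The closure of a rooted tree $T$ is obtained from $T$ by adding an edge between every vertex and each of its descendants. $C\langle h,k\rangle$ denotes the closure of the complete $k$-ary tree of depth $h$. The tree-closure-number is $\operatorname{tcn}(\mathcal{G}) := \min\{h : \exists k\ C\langle h,k\rangle \notin \mathcal{G}\}$. A path-decomposition of $G$ is a sequence of vertex subsets $(B_1,\dots,B_n)$ such that: - each vertex lies in a set of bags indexed by an interval; - each edge lies in some bag. Its width is $\max_i |B_i| - 1$. The pathwidth of $G$ is the minimum width of a path-decomposition of $G$. A class has bounded pathwidth if some constant bounds the pathwidth of all its graphs. A class $\mathcal{G}$ is minor-closed if every minor of a graph in $\mathcal{G}$ is in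 $\mathcal{G}$. *)

theory Defs
  imports
    "Graph_Theory.Graph_Theory"
    "HOL-Library.Extended_Nat"
    "HOL-Library.Disjoint_Sets"
begin

text \<open>
  Finite simple graphs are the instances of the locale \<open>pair_graph\<close>: finitely many vertices, and every
  undirected edge is represented by its two opposite arcs. The null graph is allowed.
\<close>

subsection \<open>Defective and clustered colourings\<close>

definition colouring :: "nat \<Rightarrow> 'a pair_pre_digraph \<Rightarrow> ('a \<Rightarrow> nat) \<Rightarrow> bool" where
  "colouring k G f \<longleftrightarrow> f \<in> pverts G \<rightarrow> {..<k}"

definition monochromatic_component ::
    "'a pair_pre_digraph \<Rightarrow> ('a \<Rightarrow> nat) \<Rightarrow> ('a, 'a \<times> 'a) pre_digraph \<Rightarrow> bool" where
  "monochromatic_component G f M \<longleftrightarrow>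
     (\<exists>i. pre_digraph.max_subgraph (with_proj G \<restriction> {v \<in> pverts G. f v = i}) connected M)"

text \<open>In a symmetric digraph the out-degree of a vertex is its degree in the undirected graph.\<close>

definition has_defect :: "nat \<Rightarrow> 'a pair_pre_digraph \<Rightarrow> ('a \<Rightarrow> nat) \<Rightarrow> bool" where
  "has_defect d G f \<longleftrightarrow>
     (\<forall>M. monochromatic_component G f M \<longrightarrow> (\<forall>v \<in> verts M. out_degree M v \<le> d))"

definition has_clustering :: "nat \<Rightarrow> 'a pair_pre_digraph \<Rightarrow> ('a \<Rightarrow> nat) \<Rightarrow> bool" where
  "has_clustering c G f \<longleftrightarrow>
     (\<forall>M. monochromatic_component G f M \<longrightarrow> card (verts M) \<le> c)"

text \<open>
  The minima over natural numbers are taken in \<^typ>\<open>enat\<close>, so that the minimum of the empty set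
  is \<open>\<infinity>\<close> and not an arbitrary number.
\<close>

definition chi_defective :: "'a pair_pre_digraph set \<Rightarrow> enat" where
  "chi_defective \<G> =
     Inf {enat k | k. \<exists>d. \<forall>G \<in> \<G>. \<exists>f. colouring k G f \<and> has_defect d G f}"

definition chi_clustered :: "'a pair_pre_digraph set \<Rightarrow> enat" where
  "chi_clustered \<G> =
     Inf {enat k | k. \<exists>c. \<forall>G \<in> \<G>. \<exists>f. colouring k G f \<and> has_clustering c G f}"


subsection \<open>Tree-closures\<close>

text \<open>
  Rooted trees are digraphs with arcs directed from parent to child. A vertex of the complete
  \<open>k\<close>-ary tree is the word describing the path from the root (the empty word) to it.
\<close>

definition complete_tree :: "nat \<Rightarrow> nat \<Rightarrow> nat list pair_pre_digraph" where
  "complete_tree h k =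
     (let V = {xs. set xs \<subseteq> {..<k} \<and> length xs < h}
      in \<lparr> pverts = V, parcs = {(xs, xs @ [i]) | xs i. xs \<in> V \<and> xs @ [i] \<in> V} \<rparr>)"

definition closure_of_tree :: "'a pair_pre_digraph \<Rightarrow> 'a pair_pre_digraph" where
  "closure_of_tree T = \<lparr> pverts = pverts T, parcs = (parcs T)\<^sup>+ \<union> ((parcs T)\<^sup>+)\<inverse> \<rparr>"

text \<open>
  Membership of a graph in a class is understood up to isomorphism. The depth of a rooted tree
  and the arity are positive.
\<close>

definition tcn :: "'a pair_pre_digraph set \<Rightarrow> enat" where
  "tcn \<G> = Inf {enat h | h. h \<ge> 1 \<and>
     (\<exists>k \<ge> 1. \<not> (\<exists>G \<in> \<G>.
        digraph_iso (with_proj G) (with_proj (closure_of_tree (complete_tree h k)))))}"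


subsection \<open>Pathwidth\<close>

definition path_decomposition :: "'a pair_pre_digraph \<Rightarrow> 'a set list \<Rightarrow> bool" where
  "path_decomposition G Bs \<longleftrightarrow>
     Bs \<noteq> [] \<and>
     (\<forall>B \<in> set Bs. B \<subseteq> pverts G) \<and>
     (\<forall>v \<in> pverts G. \<exists>a b. a \<le> b \<and> {i. i < length Bs \<and> v \<in> Bs ! i} = {a..b}) \<and>
     (\<forall>(u, v) \<in> parcs G. \<exists>B \<in> set Bs. u \<in> B \<and> v \<in> B)"

definition path_decomposition_width :: "'a set list \<Rightarrow> int" where
  "path_decomposition_width Bs = int (Max (card ` set Bs)) - 1"

definition pathwidth :: "'a pair_pre_digraph \<Rightarrow> int" where
  "pathwidth G = (LEAST w. \<exists>Bs. path_decomposition G Bs \<and> path_decomposition_width Bs = w)"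

definition bounded_pathwidth :: "'a pair_pre_digraph set \<Rightarrow> bool" where
  "bounded_pathwidth \<G> \<longleftrightarrow> (\<exists>w. \<forall>G \<in> \<G>. pathwidth G \<le> w)"


subsection \<open>Minors\<close>

text \<open>
  \<open>H\<close> is a minor of \<open>G\<close> if there is an \<open>H\<close>-model in \<open>G\<close>: disjoint branch sets, one for every vertex
  of \<open>H\<close>, that induce connected (in particular, nonempty) subgraphs of \<open>G\<close>, with an edge of \<open>G\<close> between
  the branch sets of any two adjacent vertices of \<open>H\<close>.
\<close>

definition minor :: "'b pair_pre_digraph \<Rightarrow> 'a pair_pre_digraph \<Rightarrow> bool" where
  "minor H G \<longleftrightarrow> (\<exists>X.
     (\<forall>v \<in> pverts H. X v \<subseteq> pverts G \<and> connected (with_proj G \<restriction> X v)) \<and>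
     disjoint_family_on X (pverts H) \<and>
     (\<forall>(u, v) \<in> parcs H. \<exists>x \<in> X u. \<exists>y \<in> X v. (x, y) \<in> parcs G))"

text \<open>
  Every finite graph has an isomorphic copy with vertices in \<^typ>\<open>nat\<close>, so classes of graphs are
  sets of graphs on natural numbers. A minor-closed class is in particular closed under
  isomorphism.
\<close>

definition minor_closed :: "nat pair_pre_digraph set \<Rightarrow> bool" where
  "minor_closed \<G> \<longleftrightarrow> (\<forall>G \<in> \<G>. \<forall>H. pair_graph H \<and> minor H G \<longrightarrow> H \<in> \<G>)"

end

theory Submission
  imports Defs
begin

text \<open>
  Greedily choose disjoint bags of a path-decomposition such that every nonempty bag meets a chosen
  one, and colour the chosen bags alternately with two colours. The other vertices have smaller
  pathwidth and are coloured recursively. Every connected monochromatic set meets at most one chosen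
  bag, so it has bounded tree-depth by induction.

  A graph \<open>G\<close> of bounded tree-depth has an elimination forest of bounded depth with connected subtrees.
  The rank of a subtree, relative to a set of ancestors, is the depth of the tree-closures
  that can be built in it with every branch set adjacent to all those ancestors. A child is rare if
  some rank that it has is shared by only a few of its siblings. Rare children inherit
  the colour of their parent; any other vertex \<open>v\<close> gets a colour that does not occur on the ancestors
  adjacent to its subtree. If those ancestors have \<open>h - 1\<close> colours, then taking one of each colour from
  bottom to top gains one rank each time, which gives a minor \<open>C\<langle>h, k\<rangle>\<close>. Otherwise \<open>h - 1\<close> colours
  suffice, and all monochromatic edges stay inside the bounded sets connected by rare children.
\<close>

section \<open>Connected sets and tree-depth\<close>

definition conn :: "('a \<times> 'a) set \<Rightarrow> 'a set \<Rightarrow> bool" where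
  "conn E U \<longleftrightarrow> U \<noteq> {} \<and> (\<forall>x\<in>U. \<forall>y\<in>U. (x, y) \<in> (Restr E U)\<^sup>*)"

lemma conn_rooted:
  assumes "sym E" "x \<in> U" "\<And>z. z \<in> U \<Longrightarrow> (x, z) \<in> (Restr E U)\<^sup>*"
  shows "conn E U"
proof -
  have "sym ((Restr E U)\<^sup>*)"
    using assms(1) by (intro sym_rtrancl) (auto simp: sym_def)
  then show ?thesis
    using assms(2,3) unfolding conn_def by (metis empty_iff rtrancl_trans symD)
qed

lemma conn_singleton: "conn E {v}"
  by (auto simp: conn_def)

lemma conn_Un:
  assumes "sym E" "conn E U" "conn E W" "x \<in> U" "y \<in> W" "(x, y) \<in> E"
  shows "conn E (U \<union> W)"
proof (rule conn_rooted[OF assms(1), of x])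
  fix z assume z: "z \<in> U \<union> W"
  have U: "(Restr E U)\<^sup>* \<subseteq> (Restr E (U \<union> W))\<^sup>*" and W: "(Restr E W)\<^sup>* \<subseteq> (Restr E (U \<union> W))\<^sup>*"
    by (intro rtrancl_mono; auto)+
  show "(x, z) \<in> (Restr E (U \<union> W))\<^sup>*"
  proof (cases "z \<in> U")
    case True
    then show ?thesis using assms U by (auto simp: conn_def)
  next
    case False
    then have "z \<in> W" using z by simp
    then have "(y, z) \<in> (Restr E W)\<^sup>*" using assms(3,5) by (simp add: conn_def)
    then have "(y, z) \<in> (Restr E (U \<union> W))\<^sup>*" using W by blast
    moreover have "(x, y) \<in> Restr E (U \<union> W)" using assms by auto
    ultimately show ?thesis by (rule converse_rtrancl_into_rtrancl[rotated])
  qed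
qed (use assms in auto)

lemma conn_induct [consumes 3, case_names base step]:
  assumes "conn E U" "z \<in> U" "x \<in> U" "P x"
    and step: "\<And>y w. y \<in> U \<Longrightarrow> w \<in> U \<Longrightarrow> (y, w) \<in> E \<Longrightarrow> P y \<Longrightarrow> P w"
  shows "P z"
proof -
  have "(x, z) \<in> (Restr E U)\<^sup>*" using assms by (auto simp: conn_def)
  then show ?thesis
    by (induction rule: rtrancl_induct) (use assms in auto)
qed

text \<open>For \<open>x\<close> outside \<open>C\<close> the reflexive closure reaches only
  \<open>x\<close>; intersecting with \<open>C\<close> then makes the component empty.\<close>

definition component :: "('a \<times> 'a) set \<Rightarrow> 'a set \<Rightarrow> 'a \<Rightarrow> 'a set" where
  "component E C x = (Restr E C)\<^sup>* `` {x} \<inter> C"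

lemma component_subset: "component E C x \<subseteq> C"
  by (auto simp: component_def)

lemma component_self: "x \<in> C \<Longrightarrow> x \<in> component E C x"
  by (auto simp: component_def)

lemma component_eq:
  assumes "sym E" "y \<in> component E C x"
  shows "component E C y = component E C x"
proof -
  have s: "sym ((Restr E C)\<^sup>*)"
    using assms(1) by (intro sym_rtrancl) (auto simp: sym_def)
  have "(x, y) \<in> (Restr E C)\<^sup>*" using assms by (auto simp: component_def)
  then show ?thesis
    using s unfolding component_def by (auto dest: symD intro: rtrancl_trans)
qed

lemma component_adjacent:
  assumes "sym E" "x \<in> C" "y \<in> C" "(x, y) \<in> E"
  shows "component E C x = component E C y"
  by (rule component_eq[OF assms(1), symmetric]) (use assms in \<open>auto simp: component_def\<close>)

lemma conn_component:
  assumes "sym E" "x \<in> C"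
  shows "conn E (component E C x)"
proof (rule conn_rooted[OF assms(1) component_self[OF assms(2)]])
  fix z assume "z \<in> component E C x"
  then have "(x, z) \<in> (Restr E C)\<^sup>*" by (auto simp: component_def)
  then show "(x, z) \<in> (Restr E (component E C x))\<^sup>*"
  proof (induction rule: rtrancl_induct)
    case (step y z)
    have "y \<in> component E C x" using step by (auto simp: component_def)
    moreover have "z \<in> component E C x"
      using step by (auto simp: component_def intro: rtrancl_into_rtrancl)
    ultimately show ?case using step by (auto intro: rtrancl_into_rtrancl)
  qed auto
qed

text \<open>Tree-depth at most \<open>n\<close>. Quantifying over all connected subsets and not only over the
  components makes monotonicity immediate.\<close>

primrec td :: "('a \<times> 'a) set \<Rightarrow> nat \<Rightarrow> 'a set \<Rightarrow> bool" where
  "td E 0 C \<longleftrightarrow> C = {}"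
| "td E (Suc n) C \<longleftrightarrow> (\<forall>D \<subseteq> C. conn E D \<longrightarrow> (\<exists>v\<in>D. td E n (D - {v})))"

lemma td_subset: "td E n C \<Longrightarrow> D \<subseteq> C \<Longrightarrow> td E n D"
  by (cases n) auto

lemma td_Suc: "td E n C \<Longrightarrow> td E (Suc n) C"
proof (induction n arbitrary: C)
  case 0
  then show ?case by (auto simp: conn_def)
next
  case (Suc n)
  then show ?case by (metis td.simps(2))
qed

lemma td_mono: "td E n C \<Longrightarrow> n \<le> m \<Longrightarrow> td E m C"
  by (rule lift_Suc_mono_le[of "\<lambda>n. Collect (td E n)", THEN subsetD, simplified])
    (auto intro: td_Suc simp del: td.simps)

text \<open>A connected subset that misses \<open>X\<close> has tree-depth at most \<open>n\<close>
  already; one that meets \<open>X\<close> spends a level on a vertex of \<open>X\<close>.\<close>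

lemma td_delete:
  assumes "td E n (C - X)" "finite X" "card X \<le> m"
  shows "td E (n + m) C"
  using assms
proof (induction m arbitrary: C X)
  case (Suc m)
  have "\<exists>v\<in>D. td E (n + m) (D - {v})" if D: "D \<subseteq> C" "conn E D" for D
  proof (cases "D \<inter> X = {}")
    case True
    then have tD: "td E n D" using td_subset[OF Suc.prems(1)] D by blast
    obtain n' where n: "n = Suc n'"
      using tD D by (cases n) (auto simp: conn_def)
    obtain v where v: "v \<in> D" "td E n' (D - {v})" using tD D(2) unfolding n by auto
    have "td E (n + m) (D - {v})" using v(2) by (rule td_mono) (simp add: n)
    then show ?thesis using v(1) by blast
  next
    case False
    then obtain v where v: "v \<in> D" "v \<in> X" by auto
    have "td E (n + m) (D - {v})"
    proof (rule Suc.IH)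
      show "td E n (D - {v} - (X - {v}))" using Suc.prems(1) by (rule td_subset) (use D in auto)
      show "card (X - {v}) \<le> m" using Suc.prems v by simp
    qed (use Suc.prems in auto)
    then show ?thesis using v by auto
  qed
  then show ?case by simp
qed auto

lemma td_connected_subsets:
  assumes "\<And>D. D \<subseteq> C \<Longrightarrow> conn E D \<Longrightarrow> td E n D"
  shows "td E n C"
proof (cases n)
  case 0
  then show ?thesis using assms[of "{x}" for x] conn_singleton[of E] by auto
next
  case (Suc m)
  then show ?thesis using assms by auto
qed

section \<open>Two colours suffice for bounded tree-depth\<close>

text \<open>A path-decomposition is given by the first bag \<open>l v\<close> and the last bag \<open>r v\<close> of every vertex.\<close>

locale interval_representation =
  fixes E :: "('a \<times> 'a) set" and l r :: "'a \<Rightarrow> nat"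
  assumes le: "l v \<le> r v"
    and overlap: "(u, v) \<in> E \<Longrightarrow> l u \<le> r v"
    and symE: "sym E"
begin

definition bag :: "'a set \<Rightarrow> nat \<Rightarrow> 'a set" where
  "bag V i = {v \<in> V. l v \<le> i \<and> i \<le> r v}"

text \<open>Adjacent intervals intersect, so a path in \<open>D\<close> cannot jump over a position
  that no interval of \<open>D\<close> covers.\<close>

lemma conn_one_side:
  assumes "conn E D" "bag D t = {}" "x \<in> D" "y \<in> D" "r x < t"
  shows "r y < t"
  using assms(1,4,3)
proof (induction rule: conn_induct)
  case (step y w)
  have "l w \<le> r y" using step overlap symE by (meson symD)
  moreover have "w \<notin> bag D t" using assms(2) by simp
  ultimately show ?case using step by (simp add: bag_def)
qed (use assms in auto)

text \<open>Colouring one family of disjoint bags lowers the maximum bag size by one and costs at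
  most one bag of extra levels; the costs add up to the triangular sum.\<close>

lemma two_colouring:
  assumes "finite V" "\<And>i. card (bag V i) \<le> q"
  shows "\<exists>g :: 'a \<Rightarrow> bool. \<forall>b. td E (\<Sum>i\<le>q. i) {v \<in> V. g v = b}"
  using assms
proof (induction q arbitrary: V)
  case 0
  have "v \<notin> V" for v
    using 0(2)[of "l v"] 0(1) le by (auto simp: bag_def)
  then show ?case by auto
next
  case (Suc q)
  \<comment> \<open>Positions of the chosen bags: the next one is just after all intervals in the
    bag at \<open>t i\<close> have ended. Inserting \<open>t i\<close> makes \<open>t\<close>
    advance past empty bags too.\<close>
  define t where "t = rec_nat 0 (\<lambda>_ s. Suc (Max (insert s (r ` bag V s))))"
  have fin: "finite (bag V i)" for i using Suc by (auto simp: bag_def)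
  have t0: "t 0 = 0" and tS: "t (Suc i) = Suc (Max (insert (t i) (r ` bag V (t i))))" for i
    by (simp_all add: t_def)
  have t_less: "t i < t (Suc i)" for i unfolding tS using fin by (simp add: less_Suc_eq_le)
  then have mono: "strict_mono t" by (simp add: strict_mono_Suc_iff)
  have r_less: "r v < t (Suc i)" if "v \<in> bag V (t i)" for v i
    unfolding tS using fin that by (simp add: less_Suc_eq_le) 
  define X where "X = (\<Union>i. bag V (t i))"
  define par where "par v = even (LEAST i. v \<in> bag V (t i))" for v
  have unique: "i = j" if "v \<in> bag V (t i)" "v \<in> bag V (t j)" for v i j
  proof -
    have False if "v \<in> bag V (t i)" "v \<in> bag V (t j)" "i < j" for i j
    proof -
      have "t (Suc i) \<le> t j" using mono that by (simp add: strict_mono_less_eq)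
      then show False using r_less[OF that(1)] that by (auto simp: bag_def)
    qed
    then show ?thesis using that by (metis linorder_neqE_nat)
  qed
  have par: "par v = even i" if "v \<in> bag V (t i)" for v i
    using unique[OF that LeastI[of "\<lambda>i. v \<in> bag V (t i)", OF that]] by (simp add: par_def)
  \<comment> \<open>Every nonempty bag loses a vertex: for the last \<open>t i \<le> j\<close>,
    either \<open>j = t i\<close> or some vertex of the bag at \<open>t i\<close> is still present
    at \<open>j\<close>.\<close>
  have load: "card (bag (V - X) j) \<le> q" for j
  proof (cases "bag V j = {}")
    case True
    then have "bag (V - X) j = {}" by (auto simp: bag_def)
    then show ?thesis by simp
  next
    case False
    define i where "i = (GREATEST i. t i \<le> j)"
    have bound: "k \<le> j" if "t k \<le> j" for k
      using strict_mono_imp_increasing[OF mono, of k] that by linarith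
    have ti: "t i \<le> j" unfolding i_def
      by (rule GreatestI_nat[of _ 0 j]) (use t0 bound in auto)
    have "\<not> t (Suc i) \<le> j"
    proof
      assume "t (Suc i) \<le> j"
      then have "Suc i \<le> (GREATEST i. t i \<le> j)"
        by (rule Greatest_le_nat) (rule bound)
      then show False by (simp add: i_def)
    qed
    then have "j \<le> Max (insert (t i) (r ` bag V (t i)))" unfolding tS by simp
    then have "j \<le> t i \<or> (\<exists>v\<in>bag V (t i). j \<le> r v)"
      using fin by (subst (asm) Max_ge_iff) auto
    then have "\<exists>v. v \<in> bag V j \<inter> X"
    proof
      assume "j \<le> t i"
      then have "j = t i" using ti by simp
      then show ?thesis using False by (auto simp: X_def)
    next
      assume "\<exists>v\<in>bag V (t i). j \<le> r v"
      then show ?thesis using ti by (force simp: X_def bag_def)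
    qed
    then obtain v where "v \<in> bag V j" "v \<in> X" by auto
    then have "bag (V - X) j \<subset> bag V j" by (auto simp: bag_def)
    then have "card (bag (V - X) j) < card (bag V j)" by (intro psubset_card_mono fin)
    then show ?thesis using Suc.prems(2)[of j] by simp
  qed
  have "\<exists>g :: 'a \<Rightarrow> bool. \<forall>b. td E (\<Sum>i\<le>q. i) {v \<in> V - X. g v = b}"
    using Suc.prems(1) load by (intro Suc.IH) auto
  then obtain g :: "'a \<Rightarrow> bool" where g: "td E (\<Sum>i\<le>q. i) {v \<in> V - X. g v = b}" for b
    by blast
  define f where "f v = (if v \<in> X then par v else g v)" for v
  have "td E (\<Sum>i\<le>Suc q. i) {v \<in> V. f v = b}" for b
  proof (rule td_connected_subsets)
    fix D assume D: "D \<subseteq> {v \<in> V. f v = b}" "conn E D"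
    \<comment> \<open>Two chosen bags of the same colour have a chosen position of the other colour
      between them. No vertex of \<open>D\<close> is present there, so \<open>D\<close> cannot reach
      across.\<close>
    have *: False if "x \<in> D" "x \<in> bag V (t i)" "y \<in> D" "y \<in> bag V (t k)" "i < k" for x y i k
    proof -
      have fx: "f x = even i" "f y = even k" using par that by (auto simp: f_def X_def)
      then have "even i = even k" using D that by auto
      then have "Suc i \<noteq> k" by auto
      then have k: "t (Suc i) < t k" using that(5) mono by (simp add: strict_mono_less)
      have "bag D (t (Suc i)) = {}"
      proof (rule ccontr)
        assume "bag D (t (Suc i)) \<noteq> {}"
        then obtain z where "z \<in> D" "z \<in> bag V (t (Suc i))" using D by (auto simp: bag_def)
        moreover then have "f z = even (Suc i)" using par by (auto simp: f_def X_def)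
        ultimately show False using fx D that by auto
      qed
      from conn_one_side[OF D(2) this that(1,3) r_less[OF that(2)]]
      show False using k that(4) by (auto simp: bag_def)
    qed
    have "\<exists>i. D \<inter> X \<subseteq> bag V (t i)"
    proof (cases "D \<inter> X = {}")
      case False
      then obtain x i where "x \<in> D" "x \<in> bag V (t i)" by (auto simp: X_def)
      have "y \<in> bag V (t i)" if "y \<in> D" "y \<in> bag V (t k)" for y k
        using *[OF \<open>x \<in> D\<close> \<open>x \<in> bag V (t i)\<close> that] *[OF that \<open>x \<in> D\<close> \<open>x \<in> bag V (t i)\<close>] that(2)
        by (cases i k rule: linorder_cases) auto
      then have "D \<inter> X \<subseteq> bag V (t i)" by (auto simp: X_def)
      then show ?thesis ..
    qed auto
    then obtain i where i: "D \<inter> X \<subseteq> bag V (t i)" ..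
    have "td E ((\<Sum>i\<le>q. i) + Suc q) D"
    proof (rule td_delete)
      show "td E (\<Sum>i\<le>q. i) (D - D \<inter> X)"
        using g[of b] by (rule td_subset) (use D in \<open>auto simp: f_def\<close>)
      show "finite (D \<inter> X)" using i fin finite_subset by blast
      show "card (D \<inter> X) \<le> Suc q" using card_mono[OF fin i] Suc.prems(2) le_trans by blast
    qed
    then show "td E (\<Sum>i\<le>Suc q. i) D" by simp
  qed
  then show ?case by auto
qed

end

section \<open>Elimination forests\<close>

text \<open>\<open>A v\<close> is the set of ancestors of \<open>v\<close>, including \<open>v\<close>. Unlike in a general elimination forest,
  every subtree is required to induce a connected graph.\<close>

locale elimination_forest =
  fixes E :: "('a \<times> 'a) set" and V :: "'a set" and A :: "'a \<Rightarrow> 'a set" and d :: nat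
  assumes symE: "sym E"
    and finV: "finite V"
    and anc_subset: "v \<in> V \<Longrightarrow> A v \<subseteq> V"
    and root_or_child: "v \<in> V \<Longrightarrow> A v = {v} \<or> (\<exists>u\<in>V. v \<notin> A u \<and> A v = insert v (A u))"
    and edge_anc: "(x, y) \<in> E \<Longrightarrow> x \<in> V \<Longrightarrow> y \<in> V \<Longrightarrow> x \<in> A y \<or> y \<in> A x"
    and conn_subtree: "v \<in> V \<Longrightarrow> conn E {u \<in> V. v \<in> A u}"
    and depth: "v \<in> V \<Longrightarrow> card (A v) \<le> d"

text \<open>Each component gets as root a vertex whose removal lowers the tree-depth, above a
  recursively built forest of the rest. Working by components keeps subtrees connected: that of a
  root is its whole component.\<close>

lemma elimination_forest_exists:
  assumes "sym E" "finite V" "td E d V"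
  shows "\<exists>A. elimination_forest E V A d"
  using assms(2,3)
proof (induction d arbitrary: V)
  case 0
  then show ?case using assms(1) by (auto simp: elimination_forest_def)
next
  case (Suc d)
  define cc where "cc = component E V"
  have cc_eq: "cc y = cc x" if "y \<in> cc x" for x y
    using component_eq[OF assms(1)] that by (auto simp: cc_def)
  have cc_self: "x \<in> cc x" if "x \<in> V" for x
    using component_self that by (auto simp: cc_def)
  have cc_sub: "cc x \<subseteq> V" for x
    unfolding cc_def by (rule component_subset)
  have "\<exists>v\<in>D. td E d (D - {v})" if "D \<in> cc ` V" for D
    using that Suc.prems(2) conn_component[OF assms(1)] component_subset[of E V]
    unfolding cc_def by auto
  then obtain R where R: "\<And>D. D \<in> cc ` V \<Longrightarrow> R D \<in> D \<and> td E d (D - {R D})"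
    by metis
  have "\<exists>A. elimination_forest E (D - {R D}) A d" if "D \<in> cc ` V" for D
  proof (rule Suc.IH)
    show "finite (D - {R D})" using that Suc.prems(1) cc_sub finite_subset by blast
  qed (use R that in auto)
  then obtain F where F: "\<And>D. D \<in> cc ` V \<Longrightarrow> elimination_forest E (D - {R D}) (F D) d"
    by metis
  define A where "A x = (if x = R (cc x) then {x} else insert (R (cc x)) (F (cc x) x))" for x
  have R_cc: "R (cc x) \<in> cc x" "R (cc x) \<in> V" "cc (R (cc x)) = cc x" if "x \<in> V" for x
    using R[of "cc x"] that cc_sub cc_eq by auto
  have A_root: "A x = {x}" if "x = R (cc x)" for x using that by (simp add: A_def)
  have A_root': "A (R (cc x)) = {R (cc x)}" if "x \<in> V" for x
    using R_cc[OF that] by (simp add: A_def)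
  have A_other: "A x = insert (R (cc x)) (F (cc x) x)" if "x \<noteq> R (cc x)" for x
    using that by (simp add: A_def)
  have F_cc: "elimination_forest E (cc x - {R (cc x)}) (F (cc x)) d" if "x \<in> V" for x
    using F that by auto
  have F_sub: "F (cc x) x \<subseteq> cc x - {R (cc x)}" if "x \<in> V" "x \<noteq> R (cc x)" for x
    using elimination_forest.anc_subset[OF F_cc[OF that(1)], of x] cc_self that by auto
  have A_cc: "A x \<subseteq> cc x" if "x \<in> V" for x
    using F_sub[of x] that cc_self R_cc by (cases "x = R (cc x)") (auto simp: A_root A_other)
  have "elimination_forest E V A (Suc d)"
  proof
    show "sym E" "finite V" using assms Suc by auto
    show "A v \<subseteq> V" if "v \<in> V" for v using A_cc[OF that] cc_sub by blast
  next
    fix v assume v: "v \<in> V"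
    let ?D = "cc v"
    show "A v = {v} \<or> (\<exists>u\<in>V. v \<notin> A u \<and> A v = insert v (A u))"
    proof (cases "v = R ?D")
      case True
      then show ?thesis using A_root by auto
    next
      case False
      then have "v \<in> ?D - {R ?D}" using cc_self v by auto
      from elimination_forest.root_or_child[OF F_cc[OF v] this]
      show ?thesis
      proof
        assume "F ?D v = {v}"
        then have "A v = insert v (A (R ?D))" "v \<notin> A (R ?D)"
          using False A_root'[OF v] by (auto simp: A_other)
        then show ?thesis using R_cc[OF v] by blast
      next
        assume "\<exists>u\<in>?D - {R ?D}. v \<notin> F ?D u \<and> F ?D v = insert v (F ?D u)"
        then obtain u where u: "u \<in> ?D" "u \<noteq> R ?D" "v \<notin> F ?D u" "F ?D v = insert v (F ?D u)"
          by auto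
        have "A u = insert (R ?D) (F ?D u)" using u cc_eq[OF u(1)] by (simp add: A_other)
        then have "v \<notin> A u" "A v = insert v (A u)" using u False by (auto simp: A_other)
        then show ?thesis using u cc_sub by blast
      qed
    qed
  next
    fix x y assume xy: "(x, y) \<in> E" "x \<in> V" "y \<in> V"
    have eq: "cc x = cc y" unfolding cc_def using component_adjacent[OF assms(1)] xy by auto
    show "x \<in> A y \<or> y \<in> A x"
    proof (cases "x = R (cc x) \<or> y = R (cc x)")
      case True
      then show ?thesis using eq by (auto simp: A_def)
    next
      case False
      then have "x \<in> F (cc x) y \<or> y \<in> F (cc x) x"
        using elimination_forest.edge_anc[OF F_cc[OF xy(2)] xy(1)] cc_self xy eq by auto
      then show ?thesis using False eq by (auto simp: A_other)
    qed
  next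
    fix v assume v: "v \<in> V"
    let ?D = "cc v"
    have cc_u: "u \<in> ?D" if "u \<in> V" "v \<in> A u" for u
      using A_cc[OF that(1)] that cc_eq[of v u] cc_self[of u] by auto
    show "conn E {u \<in> V. v \<in> A u}"
    proof (cases "v = R ?D")
      case True
      have "v \<in> A u" if "u \<in> ?D" for u using cc_eq[OF that] True by (simp add: A_def)
      then have "{u \<in> V. v \<in> A u} = ?D" using cc_u cc_sub by blast
      then show ?thesis using conn_component[OF assms(1) v] by (simp add: cc_def)
    next
      case False
      have "v \<in> A u \<longleftrightarrow> u \<noteq> R ?D \<and> v \<in> F ?D u" if "u \<in> ?D" for u
        using cc_eq[OF that] False by (auto simp: A_def)
      then have "{u \<in> V. v \<in> A u} = {u \<in> ?D - {R ?D}. v \<in> F ?D u}"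
        using cc_u cc_sub by blast
      then show ?thesis
        using elimination_forest.conn_subtree[OF F_cc[OF v], of v] False cc_self[OF v] by auto
    qed
  next
    fix v assume v: "v \<in> V"
    show "card (A v) \<le> Suc d"
    proof (cases "v = R (cc v)")
      case False
      then have "card (F (cc v) v) \<le> d"
        using elimination_forest.depth[OF F_cc[OF v], of v] cc_self[OF v] by auto
      then show ?thesis
        using card_insert_le_m1[of "Suc d" "F (cc v) v" "R (cc v)"] False by (simp add: A_other)
    qed (simp add: A_root)
  qed
  then show ?case by blast
qed

section \<open>The ancestor order, children and subtrees\<close>

context elimination_forest
begin

definition subtree :: "'a \<Rightarrow> 'a set" where
  "subtree v = {u \<in> V. v \<in> A u}"

definition child :: "'a \<Rightarrow> 'a \<Rightarrow> bool" where
  "child u v \<longleftrightarrow> u \<in> V \<and> v \<in> V \<and> v \<notin> A u \<and> A v = insert v (A u)"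

lemma finite_anc: "v \<in> V \<Longrightarrow> finite (A v)"
  using anc_subset finV finite_subset by blast

lemma child_in: "child u v \<Longrightarrow> u \<in> V" "child u v \<Longrightarrow> v \<in> V"
  by (auto simp: child_def)

lemma finite_children: "finite {v. child u v \<and> P v}"
  by (rule finite_subset[OF _ finV]) (auto simp: child_def)

lemma forest_induct [consumes 1, case_names root child]:
  assumes "v \<in> V"
    and "\<And>v. v \<in> V \<Longrightarrow> A v = {v} \<Longrightarrow> P v"
    and "\<And>u v. child u v \<Longrightarrow> P u \<Longrightarrow> P v"
  shows "P v"
  using assms(1)
proof (induction "card (A v)" arbitrary: v rule: less_induct)
  case less
  show ?case
  proof (cases "A v = {v}")
    case False
    then obtain u where u: "u \<in> V" "v \<notin> A u" "A v = insert v (A u)"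
      using root_or_child less.prems by blast
    then have "card (A u) < card (A v)" using finite_anc by simp
    then show ?thesis using less u assms(3)[of u v] by (auto simp: child_def)
  qed (use assms(2) less.prems in auto)
qed

lemma anc_self: "v \<in> V \<Longrightarrow> v \<in> A v"
  using root_or_child by blast

lemma anc_trans: "v \<in> V \<Longrightarrow> u \<in> A v \<Longrightarrow> A u \<subseteq> A v"
  by (induction rule: forest_induct) (auto simp: child_def)

lemma anc_antisym: "v \<in> V \<Longrightarrow> u \<in> A v \<Longrightarrow> v \<in> A u \<Longrightarrow> u = v"
proof (induction rule: forest_induct)
  case (child p v)
  then show ?case using anc_trans[of p u] by (auto simp: child_def)
qed auto

lemma child_unique_parent:
  assumes "child u v" "child u' v"
  shows "u = u'"
proof -
  have "A u = A u'" "u \<in> V" "u' \<in> V" using assms by (auto simp: child_def)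
  then show ?thesis using anc_self anc_antisym by metis
qed

lemma anc_linear: "v \<in> V \<Longrightarrow> u \<in> A v \<Longrightarrow> u' \<in> A v \<Longrightarrow> u \<in> A u' \<or> u' \<in> A u"
  by (induction rule: forest_induct) (auto simp: child_def)

lemma anc_deepest: "v \<in> V \<Longrightarrow> S \<subseteq> A v \<Longrightarrow> S \<noteq> {} \<Longrightarrow> \<exists>s\<in>S. S \<subseteq> A s"
proof (induction rule: forest_induct)
  case (root v)
  then have "S = {v}" by auto
  then show ?case using root by simp
next
  case (child u v)
  show ?case
  proof (cases "v \<in> S")
    case True
    then show ?thesis using child.prems by blast
  next
    case False
    then show ?thesis using child by (auto simp: child_def)
  qed
qed

lemma subtree_mono: "u \<in> subtree v \<Longrightarrow> subtree u \<subseteq> subtree v"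
  using anc_trans by (auto simp: subtree_def)

lemma subtree_child:
  assumes "child p w" "p \<in> subtree v"
  shows "subtree w \<subseteq> subtree v"
  using assms by (intro subtree_mono) (auto simp: subtree_def child_def)

lemma subtree_children_disjoint:
  assumes "child p v" "child p w" "v \<noteq> w"
  shows "subtree v \<inter> subtree w = {}"
proof -
  have "v \<notin> A w" "w \<notin> A v" using assms by (auto simp: child_def)
  then show ?thesis using anc_linear by (auto simp: subtree_def)
qed

lemma anc_notin_subtree_child:
  assumes "child p w" "p \<in> subtree s"
  shows "s \<notin> subtree w"
  using assms anc_trans[of p s] by (auto simp: child_def subtree_def)

end

section \<open>Ranks and models of tree-closures\<close>

definition words :: "nat \<Rightarrow> nat \<Rightarrow> nat list set" where
  "words h k = {xs. set xs \<subseteq> {..<k} \<and> length xs < h}"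

text \<open>Branch sets of a model of \<open>C\<langle>h, k\<rangle>\<close> inside \<open>U\<close>, each of them adjacent to all vertices in \<open>S\<close>.\<close>

definition closure_model ::
    "('a \<times> 'a) set \<Rightarrow> nat \<Rightarrow> nat \<Rightarrow> 'a set \<Rightarrow> 'a set \<Rightarrow> (nat list \<Rightarrow> 'a set) \<Rightarrow> bool" where
  "closure_model E k h U S X \<longleftrightarrow>
     (\<forall>xs\<in>words h k. X xs \<subseteq> U \<and> conn E (X xs) \<and> (\<forall>s\<in>S. \<exists>x\<in>X xs. (s, x) \<in> E)) \<and>
     disjoint_family_on X (words h k) \<and>
     (\<forall>xs\<in>words h k. \<forall>ys. ys \<noteq> [] \<longrightarrow> xs @ ys \<in> words h k \<longrightarrow>
        (\<exists>x\<in>X xs. \<exists>y\<in>X (xs @ ys). (x, y) \<in> E))"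

lemma card_gr_inj:
  assumes "k < card W"
  obtains a where "inj_on a {..k}" "a ` {..k} \<subseteq> W"
proof -
  obtain W' where W': "W' \<subseteq> W" "card W' = Suc k"
    using assms by (meson Suc_leI obtain_subset_with_card_n)
  then have "finite W'" using card.infinite by fastforce
  then obtain a where "bij_betw a {..<Suc k} W'"
    using W' by (metis bij_betw_from_nat_into_finite)
  then show ?thesis using that[of a] W' by (auto simp: bij_betw_def lessThan_Suc_atMost)
qed

locale ranked_forest = elimination_forest E V A d
  for E :: "('a \<times> 'a) set" and V A d +
  fixes k n :: nat
begin

text \<open>Edges join only comparable vertices, so these are all the vertices of \<open>V\<close>
  outside \<open>subtree w\<close> that have a neighbour inside it.\<close>

definition nbrs :: "'a \<Rightarrow> 'a set" where
  "nbrs w = {u \<in> A w - {w}. \<exists>x\<in>subtree w. (u, x) \<in> E}"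

text \<open>Rank \<open>m\<close> certifies a tree-closure of depth \<open>m + 1\<close>. The vertex
  \<open>s\<close> will join the root branch set, so everything below must be adjacent to
  \<open>s\<close> as well; the children in question hang at \<open>p\<close>, which is
  \<open>s\<close> or any descendant of it.\<close>

primrec rank :: "nat \<Rightarrow> 'a \<Rightarrow> 'a set \<Rightarrow> bool" where
  "rank 0 w S \<longleftrightarrow> S \<subseteq> nbrs w"
| "rank (Suc m) w S \<longleftrightarrow>
     (\<exists>s\<in>subtree w. \<exists>p\<in>subtree s. k < card {v. child p v \<and> rank m v (insert s S)})"

lemma rank_adjacent: "rank m w S \<Longrightarrow> s \<in> S \<Longrightarrow> \<exists>x\<in>subtree w. (s, x) \<in> E"
proof (induction m arbitrary: w S)
  case (Suc m)
  then obtain t p where tp: "t \<in> subtree w" "p \<in> subtree t"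
    and c: "k < card {v. child p v \<and> rank m v (insert t S)}" by auto
  have "{v. child p v \<and> rank m v (insert t S)} \<noteq> {}"
    using c by (metis card.empty not_less_zero)
  then obtain v where v: "child p v" "rank m v (insert t S)" by auto
  have "subtree v \<subseteq> subtree w" using subtree_child[OF v(1) tp(2)] subtree_mono[OF tp(1)] by auto
  then show ?case using Suc.IH[OF v(2)] Suc.prems(2) by auto
qed (auto simp: nbrs_def)

text \<open>Of the \<open>k + 1\<close> chosen children, the first \<open>k\<close> carry the models
  below the root. The spare one, \<open>a k\<close>, is merged with \<open>s\<close> into the root
  branch set, since \<open>s\<close> alone need not be adjacent to \<open>S\<close>.\<close>

lemma rank_model:
  assumes "rank m w S" "w \<in> V"
  shows "\<exists>X. closure_model E k (Suc m) (subtree w) S X"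
  using assms
proof (induction m arbitrary: w S)
  case 0
  have "words (Suc 0) k = {[]}" by (auto simp: words_def)
  moreover have "conn E (subtree w)" using conn_subtree[OF 0(2)] by (simp add: subtree_def)
  ultimately have "closure_model E k (Suc 0) (subtree w) S (\<lambda>_. subtree w)"
    using 0 by (auto simp: closure_model_def nbrs_def disjoint_family_on_def)
  then show ?case by blast
next
  case (Suc m)
  then obtain s p where sp: "s \<in> subtree w" "p \<in> subtree s"
    and c: "k < card {v. child p v \<and> rank m v (insert s S)}" by auto
  obtain a where "inj_on a {..k}" "a ` {..k} \<subseteq> {v. child p v \<and> rank m v (insert s S)}"
    using card_gr_inj[OF c] .
  then have a: "inj_on a {..k}" "\<And>i. i \<le> k \<Longrightarrow> child p (a i)"
    "\<And>i. i \<le> k \<Longrightarrow> rank m (a i) (insert s S)"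
    by auto
  have "\<forall>i\<in>{..k}. \<exists>X. closure_model E k (Suc m) (subtree (a i)) (insert s S) X"
    using Suc.IH a(2,3) child_in(2) by blast
  then obtain Y where Y: "closure_model E k (Suc m) (subtree (a i)) (insert s S) (Y i)"
    if "i \<le> k" for i
    unfolding bchoice_iff by blast
  define X where "X xs = (case xs of [] \<Rightarrow> insert s (subtree (a k)) | i # ys \<Rightarrow> Y i ys)" for xs
  have X_Nil: "X [] = insert s (subtree (a k))" and X_Cons: "X (i # ys) = Y i ys" for i ys
    by (auto simp: X_def)
  have sub: "subtree (a i) \<subseteq> subtree w" if "i \<le> k" for i
    using subtree_child[OF a(2)[OF that] sp(2)] subtree_mono[OF sp(1)] by auto
  have disj: "subtree (a i) \<inter> subtree (a j) = {}" if "i \<le> k" "j \<le> k" "i \<noteq> j" for i j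
    using subtree_children_disjoint a that by (metis atMost_iff inj_onD)
  have s_notin: "s \<notin> subtree (a i)" if "i \<le> k" for i
    using anc_notin_subtree_child[OF a(2)[OF that] sp(2)] .
  have words_Cons: "i # ys \<in> words (Suc (Suc m)) k \<longleftrightarrow> i < k \<and> ys \<in> words (Suc m) k" for i ys
    by (auto simp: words_def)
  have YD: "Y i ys \<subseteq> subtree (a i)" "conn E (Y i ys)" "\<And>t. t \<in> insert s S \<Longrightarrow> \<exists>x\<in>Y i ys. (t, x) \<in> E"
    if "i < k" "ys \<in> words (Suc m) k" for i ys
    using Y[of i] that by (auto simp: closure_model_def)
  have Ydisj: "Y i ys \<inter> Y i zs = {}"
    if "i < k" "ys \<in> words (Suc m) k" "zs \<in> words (Suc m) k" "ys \<noteq> zs" for i ys zs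
    using Y[of i] that by (auto simp: closure_model_def disjoint_family_on_def)
  have Yadj: "\<exists>x\<in>Y i xs. \<exists>y\<in>Y i (xs @ ys). (x, y) \<in> E"
    if "i < k" "xs \<in> words (Suc m) k" "xs @ ys \<in> words (Suc m) k" "ys \<noteq> []" for i xs ys
    using Y[of i] that by (auto simp: closure_model_def)
  have "conn E (insert s (subtree (a k)))"
  proof -
    obtain x where x: "x \<in> subtree (a k)" "(s, x) \<in> E"
      using rank_adjacent[OF a(3)[of k], of s] by auto
    have "conn E (subtree (a k))"
      using conn_subtree[of "a k"] a(2)[of k] child_in by (simp add: subtree_def)
    from conn_Un[OF symE conn_singleton this _ x] show ?thesis by simp
  qed
  then have nodes: "X xs \<subseteq> subtree w \<and> conn E (X xs) \<and> (\<forall>t\<in>S. \<exists>x\<in>X xs. (t, x) \<in> E)"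
    if "xs \<in> words (Suc (Suc m)) k" for xs
  proof (cases xs)
    case Nil
    then show ?thesis
      using \<open>conn E (insert s (subtree (a k)))\<close> sub[of k] sp(1) rank_adjacent[OF a(3)[of k]]
      by (auto simp: X_Nil)
  next
    case (Cons i ys)
    then have "i < k" "ys \<in> words (Suc m) k" using that by (auto simp: words_Cons)
    then show ?thesis using YD[of i ys] sub[of i] by (auto simp: Cons X_Cons)
  qed
  have Nil_disj: "X [] \<inter> X (i # ys) = {}" if "i < k" "ys \<in> words (Suc m) k" for i ys
    using YD(1)[OF that] s_notin[of i] disj[of i k] that(1) by (auto simp: X_Nil X_Cons)
  have "X xs \<inter> X ys = {}"
    if xs: "xs \<in> words (Suc (Suc m)) k" and ys: "ys \<in> words (Suc (Suc m)) k" and ne: "xs \<noteq> ys" for xs ys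
  proof (cases xs)
    case Nil
    then show ?thesis using ys ne Nil_disj by (cases ys) (auto simp: words_Cons)
  next
    case xs_Cons: (Cons i xs')
    show ?thesis
    proof (cases ys)
      case Nil
      then show ?thesis using xs xs_Cons Nil_disj by (auto simp: words_Cons)
    next
      case ys_Cons: (Cons j ys')
      have ij: "i < k" "xs' \<in> words (Suc m) k" "j < k" "ys' \<in> words (Suc m) k"
        using xs ys by (auto simp: xs_Cons ys_Cons words_Cons)
      show ?thesis
      proof (cases "i = j")
        case True
        then show ?thesis using Ydisj[of i xs' ys'] ij ne by (auto simp: xs_Cons ys_Cons X_Cons)
      next
        case False
        then show ?thesis
          using YD(1)[of i xs'] YD(1)[of j ys'] disj[of i j] ij
          by (auto simp: xs_Cons ys_Cons X_Cons)
      qed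
    qed
  qed
  then have "disjoint_family_on X (words (Suc (Suc m)) k)"
    by (auto simp: disjoint_family_on_def)
  moreover have "\<exists>x\<in>X xs. \<exists>y\<in>X (xs @ ys). (x, y) \<in> E"
    if h: "xs \<in> words (Suc (Suc m)) k" "ys \<noteq> []" "xs @ ys \<in> words (Suc (Suc m)) k" for xs ys
  proof (cases xs)
    case Nil
    obtain i ys' where ys: "ys = i # ys'" using h(2) by (cases ys) auto
    then have "i < k" "ys' \<in> words (Suc m) k" using h(3) Nil by (auto simp: words_Cons)
    then show ?thesis using YD(3)[of i ys' s] by (auto simp: Nil ys X_Nil X_Cons)
  next
    case (Cons i xs')
    then show ?thesis using Yadj[of i xs' ys] h by (auto simp: X_Cons words_Cons)
  qed
  ultimately show ?case unfolding closure_model_def using nodes by blast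
qed

section \<open>Colouring an elimination forest\<close>

text \<open>A child of \<open>u\<close> that is not rare shares each rank \<open>m \<le> n\<close>
  that it has over some \<open>S \<subseteq> A u\<close> with more than \<open>k\<close> children of
  \<open>u\<close>, itself included; this is what the successor case of \<open>rank\<close>
  consumes.\<close>

definition rare :: "('a \<times> 'a) set" where
  "rare = {(u, v). child u v \<and>
     (\<exists>m\<le>n. \<exists>S\<subseteq>A u. rank m v S \<and> card {w. child u w \<and> rank m w S} \<le> k)}"

lemma rare_child: "(u, v) \<in> rare \<Longrightarrow> child u v"
  by (auto simp: rare_def)

lemma rare_unique_parent:
  assumes "(u, v) \<in> rare" "(u', v) \<in> rare"
  shows "u = u'"
  using assms child_unique_parent rare_child by blast

text \<open>There are \<open>n + 1\<close> ranks and at most \<open>2 ^ d\<close> sets of ancestors,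
  and each pair makes at most \<open>k\<close> children rare.\<close>

lemma card_rare_children: "card (rare `` {u}) \<le> (n + 1) * 2 ^ d * k"
proof (cases "u \<in> V")
  case True
  define I where "I = {(m, S). m \<le> n \<and> S \<subseteq> A u \<and> card {w. child u w \<and> rank m w S} \<le> k}"
  have I: "I \<subseteq> {..n} \<times> Pow (A u)" by (auto simp: I_def)
  have fin: "finite ({..n} \<times> Pow (A u))" using finite_anc True by auto
  have "card I \<le> card ({..n} \<times> Pow (A u))" using card_mono[OF fin I] .
  also have "\<dots> = (n + 1) * 2 ^ card (A u)" using finite_anc[OF True] by (simp add: card_cartesian_product card_Pow)
  also have "\<dots> \<le> (n + 1) * 2 ^ d" using depth[OF True] by (intro mult_left_mono power_increasing) auto
  finally have cI: "card I \<le> (n + 1) * 2 ^ d" .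
  have "rare `` {u} \<subseteq> (\<Union>(m, S)\<in>I. {w. child u w \<and> rank m w S})"
    by (auto simp: rare_def I_def)
  then have "card (rare `` {u}) \<le> card (\<Union>(m, S)\<in>I. {w. child u w \<and> rank m w S})"
    using finite_subset[OF I fin] finite_children by (intro card_mono) auto
  also have "\<dots> \<le> (\<Sum>(m, S)\<in>I. card {w. child u w \<and> rank m w S})"
    using card_UN_le[OF finite_subset[OF I fin], of "\<lambda>(m, S). {w. child u w \<and> rank m w S}"]
    by (simp add: case_prod_unfold)
  also have "\<dots> \<le> (\<Sum>(m, S)\<in>I. k)" by (intro sum_mono) (auto simp: I_def)
  also have "\<dots> \<le> (n + 1) * 2 ^ d * k" using cI by (simp add: case_prod_unfold)
  finally show ?thesis .
next
  case False
  then have "rare `` {u} = {}" by (auto simp: rare_def child_def)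
  then show ?thesis by simp
qed

text \<open>These are the roots of the forest formed by the rare arcs, where a new colour is chosen;
  all other vertices of \<open>V\<close> copy their parent.\<close>

definition anchored :: "'a \<Rightarrow> bool" where
  "anchored v \<longleftrightarrow> v \<in> V \<and> (\<forall>u. (u, v) \<notin> rare)"

lemma anchor_exists: "v \<in> V \<Longrightarrow> \<exists>a. anchored a \<and> (a, v) \<in> rare\<^sup>*"
proof (induction rule: forest_induct)
  case (root v)
  have "(u, v) \<notin> rare" for u
  proof
    assume "(u, v) \<in> rare"
    then have "child u v" by (rule rare_child)
    then show False using root anc_self[of u] by (auto simp: child_def)
  qed
  then have "anchored v" using root by (simp add: anchored_def)
  then show ?case by blast
next
  case (child u v)
  show ?case
  proof (cases "anchored v")
    case True
    then show ?thesis by blast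
  next
    case False
    then obtain u' where u': "(u', v) \<in> rare" using child child_in by (auto simp: anchored_def)
    then have "u' = u" using child(1) rare_child child_unique_parent by blast
    then show ?thesis using child u' by (meson rtrancl_into_rtrancl)
  qed
qed

end

section \<open>Rare paths and the greedy colouring\<close>

context ranked_forest
begin

lemma rare_path_in:
  assumes "(a, v) \<in> rare\<^sup>*" "a \<in> V"
  shows "v \<in> V" "a \<in> A v"
  using assms by (induction rule: rtrancl_induct) (auto dest!: rare_child simp: anc_self child_def)

text \<open>Each rare arc adds exactly one ancestor, so the path from \<open>a\<close> to
  \<open>v\<close> visits every ancestor that \<open>v\<close> has beyond those of
  \<open>a\<close>.\<close>

lemma rare_path_anc:
  assumes "(a, v) \<in> rare\<^sup>*" "a \<in> V" "z \<in> A v" "z \<notin> A a"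
  shows "(a, z) \<in> rare\<^sup>*" "(z, v) \<in> rare\<^sup>*"
proof -
  have "(a, z) \<in> rare\<^sup>* \<and> (z, v) \<in> rare\<^sup>*"
    using assms(1,3)
  proof (induction rule: rtrancl_induct)
    case base
    then show ?case using assms(4) by simp
  next
    case (step u v)
    then have "z = v \<or> z \<in> A u" using rare_child by (auto simp: child_def)
    then show ?case using step by (auto intro: rtrancl_into_rtrancl)
  qed
  then show "(a, z) \<in> rare\<^sup>*" "(z, v) \<in> rare\<^sup>*" by auto
qed

lemma anchor_unique:
  assumes "(a, v) \<in> rare\<^sup>*" "(b, v) \<in> rare\<^sup>*" "anchored a" "anchored b"
  shows "a = b"
  using assms(1,2)
proof (induction rule: rtrancl_induct)
  case base
  then show ?case using assms(3) by (auto simp: anchored_def elim: rtranclE)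
next
  case (step u v)
  have "v \<noteq> b" using step assms(4) by (auto simp: anchored_def)
  then obtain u' where "(b, u') \<in> rare\<^sup>*" "(u', v) \<in> rare"
    using step.prems by (metis rtranclE)
  then show ?case using step rare_unique_parent by blast
qed

text \<open>The condition on \<open>c\<close> is confined to ancestors of \<open>v\<close>, so that
  it can be applied to a colouring still under construction.\<close>

lemma rare_path_colour:
  assumes "(z, v) \<in> rare\<^sup>*" "z \<in> V" "\<And>u y. y \<in> A v \<Longrightarrow> (u, y) \<in> rare \<Longrightarrow> c y = c u"
  shows "c v = c z"
  using assms(1,3)
proof (induction rule: rtrancl_induct)
  case (step u v)
  have "child u v" using step rare_child by blast
  then have "A u \<subseteq> A v" "v \<in> A v" by (auto simp: child_def)
  then show ?case using step by (metis subsetD)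
qed auto

text \<open>If \<open>w\<close> is not a rare child then it has many siblings of the same rank, and the deepest vertex of
  \<open>S\<close> gains rank from them. This passes to the anchor of that vertex, which lies below the rest of
  \<open>S\<close> because the colours of the vertices in \<open>S\<close> are distinct.\<close>

lemma distinct_colours_rank:
  assumes "anchored w" "S \<subseteq> A w - {w}" "inj_on c S" "rank m w S" "m + card S \<le> n"
    and "\<And>u y. y \<in> A w - {w} \<Longrightarrow> (u, y) \<in> rare \<Longrightarrow> c y = c u"
  shows "\<exists>x\<in>V. rank (m + card S) x {}"
  using assms
proof (induction "card S" arbitrary: m w S)
  case 0
  then have w: "w \<in> V" by (simp add: anchored_def)
  then have "finite S" using 0 finite_anc finite_subset by blast
  then show ?case using 0 w by auto
next
  case (Suc j)
  have w: "w \<in> V" using Suc by (simp add: anchored_def)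
  have finS: "finite S" using Suc(2) card.infinite by fastforce
  have "S \<noteq> {}" using Suc(2) by auto
  then have "A w \<noteq> {w}" using Suc(4) by auto
  then obtain v where v: "child v w" using root_or_child[OF w] w by (auto simp: child_def)
  then have Av: "A w - {w} = A v" by (auto simp: child_def)
  have "(v, w) \<notin> rare" using Suc by (auto simp: anchored_def)
  moreover have "m \<le> n" "S \<subseteq> A v" using Suc(4,7) Av by auto
  \<comment> \<open>As \<open>w\<close> is anchored, its rank is shared by more than
    \<open>k\<close> children of its parent \<open>v\<close>.\<close>
  ultimately have many: "k < card {u. child v u \<and> rank m u S}"
    using v Suc(6) unfolding rare_def by (metis (mono_tags, lifting) case_prodI mem_Collect_eq not_le)
  obtain s where s: "s \<in> S" "S \<subseteq> A s"
    using anc_deepest[of v S] Suc(4) \<open>S \<noteq> {}\<close> v unfolding Av by (auto simp: child_def)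
  have sv: "s \<in> A v" "s \<in> V" "v \<in> V"
    using s Suc(4) v anc_subset unfolding Av by (auto simp: child_def)
  have As: "A s \<subseteq> A w - {w}" using anc_trans[of v s] sv Av by simp
  obtain a where a: "anchored a" "(a, s) \<in> rare\<^sup>*" using anchor_exists sv by blast
  then have aV: "a \<in> V" by (simp add: anchored_def)
  have as: "a \<in> A s" using rare_path_in a aV by blast
  \<comment> \<open>A vertex of \<open>S\<close> that is not a strict ancestor of \<open>a\<close>
    lies on the rare path from \<open>a\<close> to \<open>s\<close>, so it has the colour of
    \<open>s\<close> and must be \<open>s\<close>.\<close>
  have below: "S - {s} \<subseteq> A a - {a}"
  proof
    fix z assume z: "z \<in> S - {s}"
    have zs: "z \<in> A s" "z \<in> V" using z s anc_subset sv by blast+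
    have "(z, s) \<notin> rare\<^sup>*"
    proof
      assume "(z, s) \<in> rare\<^sup>*"
      then have "c s = c z" using rare_path_colour zs Suc(8) As by blast
      then show False using Suc(5) z s by (metis Diff_iff inj_onD insertI1)
    qed
    then show "z \<in> A a - {a}" using rare_path_anc(2)[OF a(2) aV zs(1)] a(2) by blast
  qed
  have "\<exists>x\<in>V. rank (Suc m + card (S - {s})) x {}"
  proof (rule Suc.hyps(1))
    show "j = card (S - {s})" using Suc(2) s finS by simp
    show "Suc m + card (S - {s}) \<le> n" using Suc(2,7) s finS by simp
    show "inj_on c (S - {s})" using Suc(5) inj_on_subset by blast
    have "insert s (S - {s}) = S" using s by auto
    \<comment> \<open>The witnesses for the successor rank at \<open>a\<close> are \<open>s\<close>
      and the parent \<open>v\<close> of \<open>w\<close>.\<close>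
    moreover have "s \<in> subtree a" "v \<in> subtree s" using as sv by (auto simp: subtree_def)
    ultimately show "rank (Suc m) a (S - {s})" using many unfolding rank.simps by metis
    show "c y = c u" if "y \<in> A a - {a}" "(u, y) \<in> rare" for u y
      using that Suc(8)[of y u] As anc_trans[of s a] as sv by auto
  qed (use a below in auto)
  moreover have "Suc m + card (S - {s}) = m + card S" using s finS Suc(2) by (simp add: card_Diff_singleton)
  ultimately show ?case by metis
qed

text \<open>Otherwise one representative in \<open>nbrs w\<close> for each of \<open>n\<close>
  colours gives a set over which \<open>w\<close> has rank 0, and absorbing its vertices one by one
  yields rank \<open>n\<close>.\<close>

lemma card_nbrs_colours:
  assumes "anchored w" "\<And>u y. y \<in> A w - {w} \<Longrightarrow> (u, y) \<in> rare \<Longrightarrow> c y = c u"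
    and "\<And>x. x \<in> V \<Longrightarrow> \<not> rank n x {}"
  shows "card (c ` nbrs w) < n"
proof (rule ccontr)
  assume "\<not> card (c ` nbrs w) < n"
  then obtain C where C: "C \<subseteq> c ` nbrs w" "card C = n"
    by (meson not_le_imp_less obtain_subset_with_card_n not_less)
  then obtain S where S: "S \<subseteq> nbrs w" "inj_on c S" "c ` S = C"
    by (metis subset_image_inj)
  then have "card S = n" using C by (metis card_image)
  moreover have "\<exists>x\<in>V. rank (0 + card S) x {}"
    by (rule distinct_colours_rank[OF assms(1) _ S(2) _ _ assms(2)])
      (use S \<open>card S = n\<close> in \<open>auto simp: nbrs_def\<close>)
  ultimately show False using assms(3) by auto
qed

text \<open>Recursion from the roots downwards: the condition \<open>Q\<close> at \<open>v\<close>
  consults only colours of strict ancestors. An anchored vertex finds a free colour by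
  \<open>card_nbrs_colours\<close>.\<close>

lemma colouring_exists:
  assumes "\<And>x. x \<in> V \<Longrightarrow> \<not> rank n x {}"
  obtains c :: "'a \<Rightarrow> nat" where "\<And>v. v \<in> V \<Longrightarrow> c v < n"
    "\<And>u v. (u, v) \<in> rare \<Longrightarrow> c v = c u"
    "\<And>v. anchored v \<Longrightarrow> c v \<notin> c ` nbrs v"
proof -
  define R where "R = {(u, v). v \<in> V \<and> u \<in> A v - {v}}"
  define Q where "Q c v i \<longleftrightarrow>
    (v \<in> V \<longrightarrow> i < n) \<and> (\<forall>u. (u, v) \<in> rare \<longrightarrow> i = c u) \<and> (anchored v \<longrightarrow> i \<notin> c ` nbrs v)"
    for c v and i :: nat
  have "R \<subseteq> measure (\<lambda>v. card (A v))"
  proof (clarsimp simp: R_def)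
    fix u v assume uv: "v \<in> V" "u \<in> A v" "u \<noteq> v"
    have "v \<notin> A u" using uv anc_antisym by blast
    then have "A u \<subset> A v" using anc_trans uv anc_self by blast
    then show "card (A u) < card (A v)" using psubset_card_mono finite_anc uv by blast
  qed
  then have "wf R" by (rule wf_subset[OF wf_measure])
  then have "\<exists>c. \<forall>v. Q c v (c v)"
  proof (rule dependent_wf_choice)
    fix f g :: "'a \<Rightarrow> nat" and v i assume fg: "\<And>z. (z, v) \<in> R \<Longrightarrow> f z = g z"
    have "f u = g u" if "(u, v) \<in> rare" for u
      using fg[of u] rare_child[OF that] anc_self by (auto simp: R_def child_def)
    moreover have "f ` nbrs v = g ` nbrs v" if "v \<in> V"
      using fg that by (auto simp: R_def nbrs_def image_def)
    ultimately show "Q f v i = Q g v i" unfolding Q_def anchored_def by auto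
  next
    fix v and f :: "'a \<Rightarrow> nat" assume IH: "\<And>y. (y, v) \<in> R \<Longrightarrow> Q f y (f y)"
    show "\<exists>i. Q f v i"
    proof (cases "anchored v")
      case True
      have "card (f ` nbrs v) < n"
      proof (rule card_nbrs_colours[OF True _ assms])
        fix u y assume "y \<in> A v - {v}" "(u, y) \<in> rare"
        then show "f y = f u" using IH[of y] True by (auto simp: R_def Q_def anchored_def)
      qed
      moreover have "finite (nbrs v)"
        using True finite_anc[of v] by (auto simp: nbrs_def anchored_def)
      ultimately have "\<not> {..<n} \<subseteq> f ` nbrs v" using card_mono[of "f ` nbrs v" "{..<n}"] by auto
      then obtain i where "i < n" "i \<notin> f ` nbrs v" by auto
      then show ?thesis using True by (auto simp: Q_def anchored_def)
    next
      case False
      show ?thesis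
      proof (cases "v \<in> V")
        case True
        then obtain u where u: "(u, v) \<in> rare" using False by (auto simp: anchored_def)
        then have "(u, v) \<in> R" using rare_child[OF u] anc_self by (auto simp: R_def child_def)
        then have "f u < n" using IH[of u] rare_child[OF u] by (auto simp: Q_def child_def)
        then show ?thesis using u False rare_unique_parent by (auto simp: Q_def)
      next
        case False
        then show ?thesis by (auto simp: Q_def anchored_def dest!: rare_child child_in)
      qed
    qed
  qed
  then show ?thesis using that unfolding Q_def by blast
qed

text \<open>Adjacent vertices of equal colour have the same anchor, so one anchor serves all of
  \<open>D\<close>.\<close>

lemma conn_subset_rare_path:
  assumes "D \<subseteq> V" "conn E D" "\<And>x y. x \<in> D \<Longrightarrow> y \<in> D \<Longrightarrow> c x = c y"
    and c: "\<And>u v. (u, v) \<in> rare \<Longrightarrow> c v = c u" "\<And>v. anchored v \<Longrightarrow> c v \<notin> c ` nbrs v"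
  obtains a where "a \<in> V" "\<And>y. y \<in> D \<Longrightarrow> (a, y) \<in> rare\<^sup>*"
proof -
  \<comment> \<open>If \<open>x\<close> were a strict ancestor of \<open>a\<close>, its edge to
    \<open>y\<close> would put it into \<open>nbrs a\<close>, whose colours avoid
    \<open>c a = c y\<close>. So \<open>x\<close> is on the rare path from \<open>a\<close> to
    \<open>y\<close>.\<close>
  have up: "(a, x) \<in> rare\<^sup>*"
    if "anchored a" "(a, y) \<in> rare\<^sup>*" "y \<in> V" "x \<in> A y" "(x, y) \<in> E" "c x = c y" for a x y
  proof -
    have aV: "a \<in> V" using that by (simp add: anchored_def)
    have "c y = c a" using rare_path_colour[OF that(2) aV] c by blast
    then have "x \<notin> nbrs a" using c(2)[OF that(1)] that(6) by (metis imageI)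
    moreover have "y \<in> subtree a" using rare_path_in[OF that(2) aV] by (simp add: subtree_def)
    ultimately have "x \<in> A a \<Longrightarrow> x = a" using that by (auto simp: nbrs_def)
    then show ?thesis using rare_path_anc(1)[OF that(2) aV that(4)] by auto
  qed
  obtain x0 where x0: "x0 \<in> D" using assms(2) by (auto simp: conn_def)
  obtain a where a: "anchored a" "(a, x0) \<in> rare\<^sup>*" using anchor_exists x0 assms(1) by blast
  have "(a, y) \<in> rare\<^sup>*" if "y \<in> D" for y
    using assms(2) that x0
  proof (induction rule: conn_induct)
    case (step x y)
    have xy: "x \<in> V" "y \<in> V" "c x = c y"
      using step(1,2) assms(1) assms(3)[OF step(1,2)] by blast+
    from edge_anc[OF step(3) xy(1,2)] show ?case
    proof
      assume "x \<in> A y"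
      \<comment> \<open>Only the anchor of the upper end \<open>x\<close> is known here. The anchor
        of \<open>y\<close> is passed up to \<open>x\<close> and identified with \<open>a\<close> by
        uniqueness.\<close>
      obtain b where b: "anchored b" "(b, y) \<in> rare\<^sup>*" using anchor_exists xy by blast
      then have "(b, x) \<in> rare\<^sup>*" using up[OF b xy(2) \<open>x \<in> A y\<close> step(3) xy(3)] by blast
      then have "a = b" using anchor_unique step a b by blast
      then show ?thesis using b by simp
    next
      assume "y \<in> A x"
      have "(y, x) \<in> E" using symE step(3) by (rule symD)
      then show ?thesis using up[OF a(1) step(4) xy(1) \<open>y \<in> A x\<close>] xy(3) by simp
    qed
  qed (use a in auto)
  then show ?thesis using that a by (auto simp: anchored_def)
qed

text \<open>Rare arcs have bounded branching, and a rare path has at most \<open>d\<close> arcs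
  because each arc enlarges the ancestor set; the sum runs over the levels.\<close>

lemma card_rare_path:
  assumes "a \<in> V"
  shows "card (rare\<^sup>* `` {a}) \<le> (\<Sum>j\<le>d. ((n + 1) * 2 ^ d * k) ^ j)"
proof -
  define M where "M = (n + 1) * 2 ^ d * k"
  have fin: "finite ((rare ^^ j) `` {a})" for j
    by (rule finite_subset[OF _ finV]) (use rare_path_in assms relpow_imp_rtrancl in blast)
  have lev: "card ((rare ^^ j) `` {a}) \<le> M ^ j" for j
  proof (induction j)
    case (Suc j)
    have "(rare ^^ Suc j) `` {a} = (\<Union>v\<in>(rare ^^ j) `` {a}. rare `` {v})" by auto
    then have "card ((rare ^^ Suc j) `` {a}) \<le> (\<Sum>v\<in>(rare ^^ j) `` {a}. card (rare `` {v}))"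
      using card_UN_le[OF fin] by metis
    also have "\<dots> \<le> (\<Sum>v\<in>(rare ^^ j) `` {a}. M)"
      using card_rare_children by (intro sum_mono) (simp add: M_def)
    also have "\<dots> \<le> M ^ Suc j" using Suc by simp
    finally show ?case .
  qed auto
  have len: "card (A v) = card (A a) + j" if "(a, v) \<in> rare ^^ j" for v j
    using that
  proof (induction j arbitrary: v)
    case (Suc j)
    then obtain u where u: "(a, u) \<in> rare ^^ j" "(u, v) \<in> rare" by auto
    have "A v = insert v (A u)" "v \<notin> A u" "u \<in> V" using rare_child[OF u(2)] by (auto simp: child_def)
    then show ?case using Suc.IH[OF u(1)] finite_anc by simp
  qed auto
  have "rare\<^sup>* `` {a} \<subseteq> (\<Union>j\<le>d. (rare ^^ j) `` {a})"
  proof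
    fix v assume "v \<in> rare\<^sup>* `` {a}"
    then have "(a, v) \<in> rare\<^sup>*" by simp
    then obtain j where j: "(a, v) \<in> rare ^^ j" using rtrancl_imp_relpow by blast
    have "j \<le> d" using len[OF j] depth rare_path_in[OF \<open>(a, v) \<in> rare\<^sup>*\<close> assms] by fastforce
    then show "v \<in> (\<Union>j\<le>d. (rare ^^ j) `` {a})" using j by blast
  qed
  then have "card (rare\<^sup>* `` {a}) \<le> card (\<Union>j\<le>d. (rare ^^ j) `` {a})"
    using fin by (intro card_mono) auto
  also have "\<dots> \<le> (\<Sum>j\<le>d. card ((rare ^^ j) `` {a}))" by (intro card_UN_le) auto
  also have "\<dots> \<le> (\<Sum>j\<le>d. M ^ j)" using lev by (intro sum_mono) auto
  finally show ?thesis by (simp add: M_def)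
qed

end

text \<open>A vertex of rank \<open>n\<close> would yield the forbidden model of depth
  \<open>Suc n\<close>, so \<open>n\<close> colours suffice, and connected monochromatic sets lie
  among the rare descendants of one vertex.\<close>

theorem bounded_td_clustered_colouring:
  assumes "sym E" "finite V" "td E d V"
    and no_model: "\<And>X. \<not> closure_model E k (Suc n) V {} X"
  shows "\<exists>c :: 'a \<Rightarrow> nat. (\<forall>v\<in>V. c v < n) \<and>
    (\<forall>D\<subseteq>V. conn E D \<longrightarrow> (\<forall>x\<in>D. \<forall>y\<in>D. c x = c y) \<longrightarrow> card D \<le> (\<Sum>j\<le>d. ((n + 1) * 2 ^ d * k) ^ j))"
proof -
  obtain A where "elimination_forest E V A d"
    using elimination_forest_exists assms by blast
  then interpret ranked_forest E V A d k n by (rule ranked_forest.intro)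
  have "\<not> rank n x {}" if x: "x \<in> V" for x
  proof
    assume "rank n x {}"
    then obtain X where "closure_model E k (Suc n) (subtree x) {} X" using rank_model x by blast
    then have "closure_model E k (Suc n) V {} X" by (fastforce simp: closure_model_def subtree_def)
    then show False using no_model by blast
  qed
  then obtain c where c: "\<And>v. v \<in> V \<Longrightarrow> c v < n" "\<And>u v. (u, v) \<in> rare \<Longrightarrow> c v = c u"
    "\<And>v. anchored v \<Longrightarrow> c v \<notin> c ` nbrs v" using colouring_exists by blast
  have "card D \<le> (\<Sum>j\<le>d. ((n + 1) * 2 ^ d * k) ^ j)"
    if D: "D \<subseteq> V" "conn E D" and eq: "\<forall>x\<in>D. \<forall>y\<in>D. c x = c y" for D
  proof -
    obtain a where a: "a \<in> V" "\<And>y. y \<in> D \<Longrightarrow> (a, y) \<in> rare\<^sup>*"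
      using conn_subset_rare_path[OF D _ c(2,3)] eq by blast
    have "rare\<^sup>* `` {a} \<subseteq> V" using rare_path_in a(1) by blast
    then have "finite (rare\<^sup>* `` {a})" using finV finite_subset by blast
    then have "card D \<le> card (rare\<^sup>* `` {a})" using a(2) by (intro card_mono) auto
    then show ?thesis using card_rare_path[OF a(1)] by simp
  qed
  then show ?thesis using c(1) by blast
qed

section \<open>Graphs, components and path-decompositions\<close>

lemma finite_words: "finite (words h k)"
  by (rule finite_subset[OF _ finite_lists_length_le[of "{..<k}" h]]) (auto simp: words_def)

lemma pverts_closure: "pverts (closure_of_tree (complete_tree h k)) = words h k"
  by (simp add: closure_of_tree_def complete_tree_def words_def)

lemma complete_tree_trancl:
  assumes "(xs, ys) \<in> (parcs (complete_tree h k))\<^sup>+"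
  shows "xs \<in> words h k \<and> ys \<in> words h k \<and> (\<exists>zs. zs \<noteq> [] \<and> ys = xs @ zs)"
  using assms by (induction rule: trancl_induct) (auto simp: complete_tree_def words_def)

lemma parcs_closure:
  assumes "(xs, ys) \<in> parcs (closure_of_tree (complete_tree h k))"
  shows "xs \<in> words h k \<and> ys \<in> words h k \<and>
    (\<exists>zs. zs \<noteq> [] \<and> (ys = xs @ zs \<or> xs = ys @ zs))"
  using assms complete_tree_trancl by (fastforce simp: closure_of_tree_def)

lemma sym_parcs_closure: "sym (parcs (closure_of_tree T))"
  by (auto simp: closure_of_tree_def sym_def)

lemma pair_graph_finite: "pair_graph G \<Longrightarrow> finite (pverts G)"
  by (simp add: pair_graph_def pair_digraph_def pair_fin_digraph_def pair_fin_digraph_axioms_def)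

lemma pair_graph_parcs: "pair_graph G \<Longrightarrow> (x, y) \<in> parcs G \<Longrightarrow> x \<in> pverts G \<and> y \<in> pverts G"
  using pair_wf_digraph.arc_fst_in_verts pair_wf_digraph.arc_snd_in_verts
  by (fastforce simp: pair_graph_def pair_digraph_def pair_fin_digraph_def)

lemma pair_graph_sym: "pair_graph G \<Longrightarrow> sym (parcs G)"
  using pair_sym_digraph.pair_sym_arcs
  by (fastforce simp: pair_graph_def pair_pseudo_graph_def symmetric_def)

section \<open>Connected sets versus connected subgraphs; defect versus clustering\<close>

lemma connected_induce:
  assumes "conn (parcs G) U"
  shows "connected (with_proj G \<restriction> U)"
proof -
  let ?H = "mk_symmetric (with_proj G \<restriction> U)"
  have verts: "pverts ?H = U" by (simp add: mk_symmetric_def)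
  have arcs: "Restr (parcs G) U \<subseteq> parcs ?H"
    by (force simp: mk_symmetric_def induce_subgraph_def)
  have "(x, y) \<in> rtrancl_on U (parcs ?H)" if "x \<in> U" "y \<in> U" for x y
    using assms that(2,1)
  proof (induction rule: conn_induct[where x = x])
    case (step y w)
    then have "(y, w) \<in> parcs ?H" using arcs by auto
    then show ?case using step by (meson rtrancl_on_into_rtrancl_on)
  qed (use that in auto)
  then show ?thesis
    using assms unfolding connected_def strongly_connected_def reachable_def
    by (auto simp: verts conn_def)
qed

lemma monochromatic_component_props:
  assumes "pair_graph G" "monochromatic_component G f M"
  shows "verts M \<subseteq> pverts G" "conn (parcs G) (verts M)"
    "\<And>x y. x \<in> verts M \<Longrightarrow> y \<in> verts M \<Longrightarrow> f x = f y"
    "out_arcs M v \<subseteq> Pair v ` verts M"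
proof -
  obtain i where M: "pre_digraph.max_subgraph (with_proj G \<restriction> {v \<in> pverts G. f v = i}) connected M"
    using assms(2) by (auto simp: monochromatic_component_def)
  then have sub: "subgraph M (with_proj G \<restriction> {v \<in> pverts G. f v = i})" and con: "connected M"
    by (auto simp: pre_digraph.max_subgraph_def)
  show "verts M \<subseteq> pverts G" "\<And>x y. x \<in> verts M \<Longrightarrow> y \<in> verts M \<Longrightarrow> f x = f y"
    using sub by (auto simp: subgraph_def)
  have ht: "tail M = fst" "head M = snd"
    using sub by (auto simp: subgraph_def compatible_def induce_subgraph_def)
  have wf: "wf_digraph M" using sub by (simp add: subgraph_def)
  have arcs: "arcs M \<subseteq> Restr (parcs G) (verts M)"
    using sub wf_digraph.tail_in_verts[OF wf] wf_digraph.head_in_verts[OF wf]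
    by (auto simp: subgraph_def induce_subgraph_def ht)
  show "out_arcs M v \<subseteq> Pair v ` verts M" using arcs by (auto simp: out_arcs_def ht)
  \<comment> \<open>The predicate \<open>connected\<close> refers to the symmetric closure of
    \<open>M\<close>, which stays inside \<open>parcs G\<close> because that relation is
    symmetric.\<close>
  have "parcs (mk_symmetric M) \<subseteq> Restr (parcs G) (verts M)"
    using arcs pair_graph_sym[OF assms(1)] by (auto simp: mk_symmetric_def ht dest: symD)
  then have "(parcs (mk_symmetric M))\<^sup>* \<subseteq> (Restr (parcs G) (verts M))\<^sup>*" by (rule rtrancl_mono)
  moreover have "(x, y) \<in> (parcs (mk_symmetric M))\<^sup>*" if "x \<in> verts M" "y \<in> verts M" for x y
    using con that reachable_rtranclI[of "with_proj (mk_symmetric M)" x y]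
    by (auto simp: connected_def strongly_connected_def mk_symmetric_def)
  moreover have "verts M \<noteq> {}"
    using con by (auto simp: connected_def strongly_connected_def mk_symmetric_def)
  ultimately show "conn (parcs G) (verts M)" by (auto simp: conn_def)
qed

text \<open>Arcs are pairs, so those leaving a vertex are counted by their heads, which all lie in
  the component.\<close>

lemma defect_le_clustering:
  assumes "pair_graph G" "has_clustering c G f"
  shows "has_defect c G f"
  unfolding has_defect_def
proof (intro allI impI ballI)
  fix M v assume M: "monochromatic_component G f M" "v \<in> verts M"
  have fin: "finite (verts M)"
    using monochromatic_component_props(1)[OF assms(1) M(1)] pair_graph_finite[OF assms(1)]
    by (rule finite_subset)
  have "out_degree M v \<le> card (Pair v ` verts M)"
    unfolding out_degree_def using monochromatic_component_props(4)[OF assms(1) M(1)] fin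
    by (intro card_mono) auto
  also have "\<dots> \<le> card (verts M)" using fin by (rule card_image_le)
  also have "\<dots> \<le> c" using assms(2) M(1) by (simp add: has_clustering_def)
  finally show "out_degree M v \<le> c" .
qed

section \<open>From pathwidth to interval representations\<close>

lemma path_decomposition_of_pathwidth:
  assumes "pair_graph G"
  obtains Bs where "path_decomposition G Bs" "path_decomposition_width Bs = pathwidth G"
proof -
  \<comment> \<open>A \<open>LEAST\<close> over integers need not be attained, so the largest bag
    size is minimised as a natural number and then shifted by one.\<close>
  define Q where "Q m \<longleftrightarrow> (\<exists>Bs. path_decomposition G Bs \<and> Max (card ` set Bs) = m)" for m
  have "path_decomposition G [pverts G]"
    unfolding path_decomposition_def
  proof (intro conjI ballI)
    fix v assume "v \<in> pverts G"
    then have "{i. i < length [pverts G] \<and> v \<in> [pverts G] ! i} = {0..0}" by auto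
    then show "\<exists>a b. a \<le> b \<and> {i. i < length [pverts G] \<and> v \<in> [pverts G] ! i} = {a..b}" by blast
  qed (use pair_graph_parcs[OF assms] in auto)
  then have "\<exists>m. Q m" unfolding Q_def by blast
  then have "Q (LEAST m. Q m)" by (rule LeastI_ex)
  then obtain Bs where Bs: "path_decomposition G Bs" "Max (card ` set Bs) = (LEAST m. Q m)"
    by (auto simp: Q_def)
  have "pathwidth G = path_decomposition_width Bs"
    unfolding pathwidth_def
  proof (rule Least_equality)
    fix w assume "\<exists>Bs. path_decomposition G Bs \<and> path_decomposition_width Bs = w"
    then obtain Cs where "path_decomposition G Cs" and w: "path_decomposition_width Cs = w" by blast
    then have "Q (Max (card ` set Cs))" unfolding Q_def by blast
    then have "(LEAST m. Q m) \<le> Max (card ` set Cs)" by (rule Least_le)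
    then show "path_decomposition_width Bs \<le> w"
      using w Bs(2) by (simp add: path_decomposition_width_def)
  qed (use Bs in blast)
  then show ?thesis using that Bs by simp
qed

lemma pathwidth_two_colouring:
  assumes G: "pair_graph G" and w: "pathwidth G \<le> w"
  shows "\<exists>g :: 'a \<Rightarrow> bool. \<forall>b. td (parcs G) (\<Sum>i\<le>nat (w + 1). i) {v \<in> pverts G. g v = b}"
proof -
  obtain Bs where Bs: "path_decomposition G Bs" "path_decomposition_width Bs = pathwidth G"
    using path_decomposition_of_pathwidth[OF G] .
  \<comment> \<open>The locale requires \<open>l v \<le> r v\<close> at every \<open>v\<close> of
    the type, also outside the graph.\<close>
  have "\<exists>p. fst p \<le> snd p \<and>
    (v \<in> pverts G \<longrightarrow> {i. i < length Bs \<and> v \<in> Bs ! i} = {fst p..snd p})" for v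
  proof (cases "v \<in> pverts G")
    case True
    then obtain a b where "a \<le> b" "{i. i < length Bs \<and> v \<in> Bs ! i} = {a..b}"
      using Bs(1) unfolding path_decomposition_def by blast
    then show ?thesis by (intro exI[of _ "(a, b)"]) simp
  qed auto
  then obtain p where p: "\<And>v. fst (p v) \<le> snd (p v)"
    "\<And>v. v \<in> pverts G \<Longrightarrow> {i. i < length Bs \<and> v \<in> Bs ! i} = {fst (p v)..snd (p v)}"
    by metis
  have idx: "i < length Bs \<and> v \<in> Bs ! i \<longleftrightarrow> fst (p v) \<le> i \<and> i \<le> snd (p v)"
    if "v \<in> pverts G" for v i
    using p(2)[OF that] by (metis (mono_tags, lifting) atLeastAtMost_iff mem_Collect_eq)
  interpret interval_representation "parcs G" "\<lambda>v. fst (p v)" "\<lambda>v. snd (p v)"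
  proof
    fix u v assume uv: "(u, v) \<in> parcs G"
    then obtain B where "B \<in> set Bs" "u \<in> B" "v \<in> B"
      using Bs(1) unfolding path_decomposition_def by blast
    then obtain i where i: "i < length Bs" "u \<in> Bs ! i" "v \<in> Bs ! i" by (metis in_set_conv_nth)
    then show "fst (p u) \<le> snd (p v)"
      using idx[of u i] idx[of v i] pair_graph_parcs[OF G uv] by linarith
  qed (use p pair_graph_sym[OF G] in auto)
  have "card (bag (pverts G) i) \<le> nat (w + 1)" for i
  proof (cases "i < length Bs")
    case True
    have "Bs ! i \<subseteq> pverts G" using Bs(1) True by (auto simp: path_decomposition_def)
    then have "finite (Bs ! i)" using pair_graph_finite[OF G] finite_subset by blast
    moreover have "bag (pverts G) i \<subseteq> Bs ! i" using idx by (auto simp: bag_def)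
    ultimately have "card (bag (pverts G) i) \<le> card (Bs ! i)" using card_mono by blast
    also have "\<dots> \<le> Max (card ` set Bs)" using True by simp
    also have "\<dots> \<le> nat (w + 1)" using Bs(2) w by (simp add: path_decomposition_width_def)
    finally show ?thesis .
  next
    case False
    then have "bag (pverts G) i = {}" using idx by (auto simp: bag_def)
    then show ?thesis by simp
  qed
  then show ?thesis by (intro two_colouring pair_graph_finite G)
qed

text \<open>The class consists of graphs on natural numbers, so the tree-closure is copied along
  \<open>to_nat\<close>, and \<open>from_nat\<close> leads from a copied vertex back to its branch
  set.\<close>

lemma closure_model_in_class:
  fixes \<G> :: "nat pair_pre_digraph set"
  assumes "minor_closed \<G>" "G \<in> \<G>" "pair_graph G"
    and model: "closure_model (parcs G) k h (pverts G) {} X"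
  shows "\<exists>H\<in>\<G>. digraph_iso (with_proj H) (with_proj (closure_of_tree (complete_tree h k)))"
proof -
  define C where "C = closure_of_tree (complete_tree h k)"
  define H :: "nat pair_pre_digraph"
    where "H = \<lparr>pverts = to_nat ` pverts C, parcs = map_prod to_nat to_nat ` parcs C\<rparr>"
  have H: "pverts H = to_nat ` words h k" "parcs H = map_prod to_nat to_nat ` parcs C"
    by (simp_all add: H_def C_def pverts_closure)
  have "parcs C \<subseteq> words h k \<times> words h k" using parcs_closure by (fastforce simp: C_def)
  then have finC: "finite (parcs C)" using finite_words finite_subset by blast
  have inC: "xs \<in> words h k \<and> ys \<in> words h k \<and> xs \<noteq> ys" if "(xs, ys) \<in> parcs C" for xs ys
    using parcs_closure[of xs ys h k] that by (auto simp: C_def)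
  have "sym (parcs H)"
    using sym_parcs_closure[of "complete_tree h k"] unfolding H C_def sym_def by force
  then have pg: "pair_graph H"
    using inC finite_words finC
    by unfold_locales (auto simp: H symmetric_def)
  \<comment> \<open>A \<open>closure_model\<close> provides edges from a word to its extensions; the
    symmetry of \<open>G\<close> covers the opposite arcs.\<close>
  have adj: "\<exists>x\<in>X xs. \<exists>y\<in>X ys. (x, y) \<in> parcs G" if h: "(xs, ys) \<in> parcs C" for xs ys
  proof -
    have *: "\<exists>x\<in>X xs. \<exists>y\<in>X (xs @ zs). (x, y) \<in> parcs G"
      if "xs \<in> words h k" "xs @ zs \<in> words h k" "zs \<noteq> []" for xs zs
      using model that by (auto simp: closure_model_def)
    obtain zs where "xs \<in> words h k" "ys \<in> words h k" "zs \<noteq> []" "ys = xs @ zs \<or> xs = ys @ zs"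
      using parcs_closure h unfolding C_def by blast
    then show ?thesis using *[of xs zs] *[of ys zs] symD[OF pair_graph_sym[OF assms(3)]] by blast
  qed
  have "minor H G"
    unfolding minor_def
  proof (intro exI[of _ "\<lambda>v. X (from_nat v)"] conjI)
    show "\<forall>v\<in>pverts H. X (from_nat v) \<subseteq> pverts G \<and> connected (with_proj G \<restriction> X (from_nat v))"
      using model connected_induce by (auto simp: H closure_model_def)
    show "disjoint_family_on (\<lambda>v. X (from_nat v)) (pverts H)"
      using model by (auto simp: H closure_model_def disjoint_family_on_def)
    show "\<forall>(u, v)\<in>parcs H. \<exists>x\<in>X (from_nat u). \<exists>y\<in>X (from_nat v). (x, y) \<in> parcs G"
      using adj by (auto simp: H)
  qed
  then have "H \<in> \<G>" using assms pg by (auto simp: minor_closed_def)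
  moreover have "digraph_iso (with_proj H) (with_proj C)"
    unfolding digraph_iso_def
  proof (intro exI conjI)
    let ?f = "\<lparr>iso_verts = from_nat, iso_arcs = map_prod from_nat from_nat, iso_head = snd, iso_tail = fst\<rparr>
      :: (nat, nat \<times> nat, nat list, nat list \<times> nat list) digraph_isomorphism"
    have "wf_digraph (with_proj H)"
      using pg by (simp add: wf_digraph_wp_iff pair_graph_def pair_digraph_def pair_fin_digraph_def)
    then show "pre_digraph.digraph_isomorphism (with_proj H) ?f"
      by (auto simp: pre_digraph.digraph_isomorphism_def H inj_on_def)
    have "pverts C = from_nat ` pverts H" "parcs C = map_prod from_nat from_nat ` parcs H"
      by (auto simp: H C_def pverts_closure image_image map_prod_def case_prod_unfold)
    then show "with_proj C = app_iso ?f (with_proj H)"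
      by (simp add: app_iso_def with_proj_def)
  qed
  ultimately show ?thesis unfolding C_def by blast
qed

section \<open>The two inequalities\<close>

lemma chi_defective_le_chi_clustered:
  assumes "\<forall>G\<in>\<G>. pair_graph G"
  shows "chi_defective \<G> \<le> chi_clustered \<G>"
  unfolding chi_defective_def chi_clustered_def
proof (rule Inf_superset_mono, clarify)
  fix k c assume "\<forall>G\<in>\<G>. \<exists>f. colouring k G f \<and> has_clustering c G f"
  then have "\<forall>G\<in>\<G>. \<exists>f. colouring k G f \<and> has_defect c G f"
    using assms defect_le_clustering by blast
  then show "\<exists>k'. enat k = enat k' \<and> (\<exists>d. \<forall>G\<in>\<G>. \<exists>f. colouring k' G f \<and> has_defect d G f)"
    by blast
qed

text \<open>A model inside one class of \<open>g\<close> is a model in \<open>G\<close>, so each of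
  the two classes of bounded tree-depth can be coloured with \<open>n\<close> colours.\<close>

lemma clustered_colouring:
  assumes G: "pair_graph G" and w: "pathwidth G \<le> w"
    and no_model: "\<And>X. \<not> closure_model (parcs G) k (Suc n) (pverts G) {} X"
    and d: "d = (\<Sum>i\<le>nat (w + 1). i)"
  shows "\<exists>f. colouring (2 * n) G f \<and> has_clustering (\<Sum>j\<le>d. ((n + 1) * 2 ^ d * k) ^ j) G f"
proof -
  define N where "N = (\<Sum>j\<le>d. ((n + 1) * 2 ^ d * k) ^ j)"
  obtain g :: "'a \<Rightarrow> bool" where g: "td (parcs G) d {v \<in> pverts G. g v = b}" for b
    using pathwidth_two_colouring[OF G w] unfolding d by blast
  define Q where "Q b c \<longleftrightarrow> (\<forall>v\<in>{v \<in> pverts G. g v = b}. c v < n) \<and>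
    (\<forall>D\<subseteq>{v \<in> pverts G. g v = b}. conn (parcs G) D \<longrightarrow> (\<forall>x\<in>D. \<forall>y\<in>D. c x = c y) \<longrightarrow> card D \<le> N)"
    for b and c :: "'a \<Rightarrow> nat"
  have ex: "\<exists>c. Q b c" for b
    unfolding Q_def N_def
  proof (rule bounded_td_clustered_colouring)
    show "\<not> closure_model (parcs G) k (Suc n) {v \<in> pverts G. g v = b} {} X" for X
      using no_model[of X] by (auto simp: closure_model_def)
  qed (use g pair_graph_sym[OF G] pair_graph_finite[OF G] in auto)
  from choice[OF allI[OF ex]] obtain c where Q: "\<forall>b. Q b (c b)" ..
  have c: "c b v < n" if "v \<in> pverts G" "g v = b" for b v
    using spec[OF Q, of b] that by (simp add: Q_def)
  have card_le: "card D \<le> N" if "D \<subseteq> {v \<in> pverts G. g v = b}" "conn (parcs G) D"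
    "\<forall>x\<in>D. \<forall>y\<in>D. c b x = c b y" for b D
    using spec[OF Q, of b] that unfolding Q_def by blast
  \<comment> \<open>The two classes get disjoint palettes, so \<open>f\<close> determines both
    \<open>g\<close> and the colour within the class.\<close>
  define f where "f v = c (g v) v + (if g v then n else 0)" for v
  have less: "c (g v) v < n" if "v \<in> pverts G" for v using c that by blast
  have "f v < 2 * n" if "v \<in> pverts G" for v using less[OF that] by (cases "g v") (auto simp: f_def)
  then have "colouring (2 * n) G f" by (simp add: colouring_def)
  moreover have "has_clustering N G f"
    unfolding has_clustering_def
  proof (intro allI impI)
    fix M assume "monochromatic_component G f M"
    note M = monochromatic_component_props(1-3)[OF G this]
    have eq: "g x = g y \<and> c (g x) x = c (g y) y" if "x \<in> verts M" "y \<in> verts M" for x y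
    proof -
      have "f x = f y" using M(3) that .
      moreover have "c (g x) x < n" "c (g y) y < n" using M(1) less that by blast+
      ultimately show ?thesis by (cases "g x"; cases "g y") (auto simp: f_def)
    qed
    obtain x where x: "x \<in> verts M" using M(2) by (auto simp: conn_def)
    show "card (verts M) \<le> N"
    proof (rule card_le[of _ "g x"])
      show "verts M \<subseteq> {v \<in> pverts G. g v = g x}" using eq x M(1) by blast
      have "c (g x) y = c (g x) x" if "y \<in> verts M" for y using eq[OF x that] by (cases "g x") auto
      then show "\<forall>y\<in>verts M. \<forall>z\<in>verts M. c (g x) y = c (g x) z" by simp
    qed (rule M(2))
  qed
  ultimately show ?thesis unfolding N_def by blast
qed

theorem theorem2:
  fixes \<G> :: "nat pair_pre_digraph set"
  assumes "\<forall>G \<in> \<G>. pair_graph G"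
    and "minor_closed \<G>"
    and "bounded_pathwidth \<G>"
  shows "chi_defective \<G> \<le> chi_clustered \<G> \<and> chi_clustered \<G> \<le> 2 * tcn \<G> - 2"
proof
  show "chi_defective \<G> \<le> chi_clustered \<G>" using assms(1) by (rule chi_defective_le_chi_clustered)
  let ?excluded = "\<lambda>h. h \<ge> 1 \<and> (\<exists>k\<ge>1. \<not> (\<exists>G\<in>\<G>.
    digraph_iso (with_proj G) (with_proj (closure_of_tree (complete_tree h k)))))"
  show "chi_clustered \<G> \<le> 2 * tcn \<G> - 2"
  proof (cases "tcn \<G>")
    case (enat h)
    define X where "X = {enat h | h. ?excluded h}"
    \<comment> \<open>A finite infimum in \<open>enat\<close> comes from a nonempty set and is
      attained, so \<open>h\<close> itself is an excluded depth.\<close>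
    have "tcn \<G> = Inf X" by (simp only: tcn_def X_def)
    moreover from this have "X \<noteq> {}" using enat by (auto simp: Inf_enat_def)
    ultimately have "tcn \<G> \<in> X" unfolding Inf_enat_def by (metis LeastI ex_in_conv)
    then have "?excluded h" using enat by (auto simp: X_def)
    then obtain k where h: "h \<ge> 1" and
      k: "\<not> (\<exists>G\<in>\<G>. digraph_iso (with_proj G) (with_proj (closure_of_tree (complete_tree h k))))"
      by blast
    \<comment> \<open>Excluding depth \<open>Suc n\<close> gives \<open>n\<close> colours for each
      of two classes, and \<open>2 * n = 2 * h - 2\<close>.\<close>
    obtain n where n: "h = Suc n" using h by (cases h) auto
    obtain w where w: "\<forall>G\<in>\<G>. pathwidth G \<le> w" using assms(3) by (auto simp: bounded_pathwidth_def)
    define d where "d = (\<Sum>i\<le>nat (w + 1). i)"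
    have "\<exists>f. colouring (2 * n) G f \<and> has_clustering (\<Sum>j\<le>d. ((n + 1) * 2 ^ d * k) ^ j) G f"
      if "G \<in> \<G>" for G
    proof (rule clustered_colouring[OF _ _ _ d_def])
      show "\<not> closure_model (parcs G) k (Suc n) (pverts G) {} X" for X
        using closure_model_in_class[OF assms(2) that] assms(1) that k n by blast
    qed (use assms(1) w that in auto)
    then have "chi_clustered \<G> \<le> enat (2 * n)"
      unfolding chi_clustered_def by (intro Inf_lower) blast
    also have "enat (2 * n) = 2 * tcn \<G> - 2"
      unfolding enat n by (simp add: numeral_eq_enat)
    finally show ?thesis .
  next
    case infinity
    \<comment> \<open>Subtraction in \<open>enat\<close> leaves \<open>\<infinity>\<close>
      unchanged, so the bound is trivial in this case.\<close>
    have "2 * (\<infinity> :: enat) - 2 = \<infinity>" by (simp add: numeral_eq_enat)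
    then show ?thesis by (simp add: infinity)
  qed
qed

end
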